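(* Let $\nu > \frac12$. There exists a constant $C_\nu$, depending only on $\nu$ (independent of $n$, $y$ and $\lambda$), such that for every real $\lambda<2\nu$ and every $n\in\mathbb{N}$ the residual polynomials $$\tilde r_n^{(\nu)*}(y) = \frac{P_{2n}^{(\nu)*}(\sqrt{1-y})}{P_{2n}^{(\nu)*}(1)},\qquad y\in[0,1],$$ and the modulus of convergence $\varepsilon_\nu(n)$ are bounded by $$\left|\tilde r_n^{(\nu)*}(y)\right| \leq \frac{1+|\lambda|}{2\nu-\lambda}\,\frac{C_\nu}{(2\sqrt{y}\,n+1)^\nu}\quad (y\in[0,1]),\qquad \varepsilon_\nu(n)\leq \frac{1+|\lambda|}{2\nu-\lambda}\,\frac{C_\nu}{(2n)^\nu}.$$
   Context: $\mathbb{N}=\{1,2,\dots\}$. For $\nu>\frac12$ put $$\beta_n = \frac{n(n+2\nu-1)}{4(n+\nu)(n+\nu-1)},\qquad n\in\mathbb{N};$$ these are the recurrence coefficients of the monic ultraspherical polynomials, orthogonal on $[-1,1]$ with respect to $(1-x^2)^{\nu-\frac12}$. For $\lambda\in\mathbb{R}$, the co-dilated ultraspherical polynomials (with the first coefficient $\beta_1$ dilated by $\lambda$, i.e. $m=1$) are defined by $$P_0^{(\nu)*}(x)=1,\quad P_1^{(\nu)*}(x)=x,\quad P_2^{(\nu)*}(x)=x^2-\lambda\beta_1,\quad P_{n+1}^{(\nu)*}(x)=xP_n^{(\nu)*}(x)-\beta_nP_{n-1}^{(\nu)*}(x)\ \ (n\ge2).$$ Since $P_{2n}^{(\nu)*}$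 is an even polynomial of degree $2n$, $\tilde r_n^{(\nu)*}$ is a polynomial of degree $n$ in $y$. The modulus of convergence is $$\varepsilon_\nu(n)=\sup_{y\in[0,1]}\left|y^{\frac{\nu}{2}}\,\tilde r_n^{(\nu)*}(y)\right|.$$ *)

theory Defs
  imports Complex_Main "HOL-Computational_Algebra.Polynomial"
begin

definition us_beta :: "real \<Rightarrow> nat \<Rightarrow> real" where
  "us_beta \<nu> n =
    (real n * (real n + 2 * \<nu> - 1)) / (4 * (real n + \<nu>) * (real n + \<nu> - 1))"

fun codil_us :: "real \<Rightarrow> real \<Rightarrow> nat \<Rightarrow> real poly" where
  "codil_us \<nu> lam 0 = 1"
| "codil_us \<nu> lam (Suc 0) = [:0, 1:]"
| "codil_us \<nu> lam (Suc (Suc 0)) = [:0, 1:] ^ 2 - [:lam * us_beta \<nu> 1:]"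
| "codil_us \<nu> lam (Suc (Suc (Suc n))) =
    [:0, 1:] * codil_us \<nu> lam (Suc (Suc n)) - smult (us_beta \<nu> (Suc (Suc n))) (codil_us \<nu> lam (Suc n))"

definition residual :: "real \<Rightarrow> real \<Rightarrow> nat \<Rightarrow> real \<Rightarrow> real" where
  "residual \<nu> lam n y =
    poly (codil_us \<nu> lam (2 * n)) (sqrt (1 - y)) / poly (codil_us \<nu> lam (2 * n)) 1"

definition conv_modulus :: "real \<Rightarrow> real \<Rightarrow> nat \<Rightarrow> real" where
  "conv_modulus \<nu> lam n = (SUP y\<in>{0..1}. \<bar>y powr (\<nu> / 2) * residual \<nu> lam n y\<bar>)"

text \<open>For \<open>lam < 2\<nu>\<close> the denominator in \<^const>\<open>residual\<close> is positive, so the convention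
  \<open>x / 0 = 0\<close> plays no role. The bound \<open>(n + 1) / (2 (n + \<nu>))\<close> below is the ratio of
  consecutive values at \<open>1\<close> in the limiting case \<open>lam = 2\<nu>\<close>.\<close>

lemma codil_us_one_ratio:
  assumes "\<nu> > 1 / 2" "lam < 2 * \<nu>"
  shows "poly (codil_us \<nu> lam (Suc n)) 1 > 0 \<and>
    poly (codil_us \<nu> lam (Suc (Suc n))) 1
      > (real n + 2) / (2 * (real n + 1 + \<nu>)) * poly (codil_us \<nu> lam (Suc n)) 1"
proof (induction n)
  case 0
  have "us_beta \<nu> 1 = 1 / (2 * (1 + \<nu>))"
    using assms by (simp add: us_beta_def divide_simps)
  then show ?case
    using assms by (simp add: field_simps)
next
  case (Suc n)
  define a where "a = poly (codil_us \<nu> lam (Suc n)) 1"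
  define b where "b = poly (codil_us \<nu> lam (Suc (Suc n))) 1"
  define m where "m = real n + 2"
  have m: "m \<ge> 2" by (simp add: m_def)
  have a: "a > 0" and b: "b > m / (2 * (m - 1 + \<nu>)) * a"
    using Suc.IH by (simp_all add: a_def b_def m_def add_ac)
  have "m / (2 * (m - 1 + \<nu>)) * a > 0"
    using a m assms by (intro mult_pos_pos divide_pos_pos) auto
  with b have b0: "b > 0" by linarith
  have beta: "us_beta \<nu> (Suc (Suc n)) =
      m / (2 * (m - 1 + \<nu>)) * ((m + 2 * \<nu> - 1) / (2 * (m + \<nu>)))"
    by (simp add: us_beta_def m_def algebra_simps)
  have "us_beta \<nu> (Suc (Suc n)) * a =
      (m / (2 * (m - 1 + \<nu>)) * a) * ((m + 2 * \<nu> - 1) / (2 * (m + \<nu>)))"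
    by (simp only: beta ac_simps)
  also have "\<dots> < b * ((m + 2 * \<nu> - 1) / (2 * (m + \<nu>)))"
    using b m assms by (intro mult_strict_right_mono divide_pos_pos) auto
  finally have "b - us_beta \<nu> (Suc (Suc n)) * a > b - b * ((m + 2 * \<nu> - 1) / (2 * (m + \<nu>)))"
    by simp
  also have "b - b * ((m + 2 * \<nu> - 1) / (2 * (m + \<nu>))) = (m + 1) / (2 * (m + \<nu>)) * b"
    using m assms by (simp add: field_simps)
  finally show ?case
    using b0 by (simp add: a_def b_def m_def add_ac)
qed

lemma codil_us_one_pos:
  assumes "\<nu> > 1 / 2" "lam < 2 * \<nu>"
  shows "poly (codil_us \<nu> lam n) 1 > 0"
  using codil_us_one_ratio[OF assms, of "n - 1"] by (cases n) auto

end

theory Submission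
  imports Defs "HOL-Analysis.Gamma_Function"
begin

text \<open>
  Divide the co-dilated polynomials \<open>P\<^sub>n\<close> by \<open>g\<^sub>n / 2\<^sup>n\<close> with \<open>g\<^sub>n = (2\<nu>)\<^sub>n / (\<nu>)\<^sub>n\<close>, the value
  at \<open>1\<close> of the undilated polynomial. The quotients \<open>r\<^sub>n\<close> satisfy
  \<open>(2\<nu> + n) r\<^sub>n\<^sub>+\<^sub>1 = 2x (n + \<nu>) r\<^sub>n - n r\<^sub>n\<^sub>-\<^sub>1\<close> for \<open>n \<ge> 2\<close>, and \<open>\<lambda>\<close> enters only through \<open>r\<^sub>2\<close>.
  Put \<open>s = \<surd>(1 - x\<^sup>2) = \<surd>y\<close>.

  As long as \<open>s n\<close> is small, the recurrence is a perturbation of the one at \<open>x = 1\<close>, and the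
  potential \<open>(n + 1) \<bar>r\<^sub>n\<^sub>+\<^sub>1 - r\<^sub>n\<bar> + (2\<nu> - 1) \<bar>r\<^sub>n\<^sub>+\<^sub>1\<bar>\<close> stays bounded by a multiple of \<open>1 + \<bar>\<lambda>\<bar>\<close>.
  Once \<open>s n\<close> is large, \<open>p\<^sub>n = g\<^sub>n r\<^sub>n\<close> satisfies \<open>p\<^sub>n\<^sub>+\<^sub>1 = 2x p\<^sub>n - b\<^sub>n p\<^sub>n\<^sub>-\<^sub>1\<close> with
  \<open>b\<^sub>n = 1 + O(1 / n\<^sup>2)\<close>, so that the energy \<open>\<surd>((p\<^sub>n\<^sub>+\<^sub>1 - x p\<^sub>n)\<^sup>2 + s\<^sup>2 p\<^sub>n\<^sup>2)\<close> grows in each step at most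
  by the factor \<open>1 + \<bar>1 - b\<^sub>n\<bar> / s\<close>; the product of these factors over \<open>n \<ge> c / s\<close> is bounded
  independently of \<open>s\<close>. As \<open>g\<^sub>n\<close> grows like \<open>n\<^sup>\<nu>\<close>, this gives the decay
  \<open>\<bar>r\<^sub>n\<bar> \<le> K (1 + \<bar>\<lambda>\<bar>) / (s n + 1)\<^sup>\<nu>\<close>. At \<open>x = 1\<close> the recurrence integrates to
  \<open>(2\<nu> + n) r\<^sub>n\<^sub>+\<^sub>1 = (n + 1) r\<^sub>n + 2\<nu> - \<lambda>\<close>, which bounds the denominator from below by a multiple
  of \<open>2\<nu> - \<lambda>\<close>.
\<close>

section \<open>Growth of the normalizing factors\<close>

definition us_growth :: "real \<Rightarrow> nat \<Rightarrow> real" where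
  "us_growth \<nu> n = pochhammer (2 * \<nu>) n / pochhammer \<nu> n"

lemma us_growth_pos: "\<nu> > 0 \<Longrightarrow> us_growth \<nu> n > 0"
  by (simp add: us_growth_def pochhammer_pos)

lemma us_growth_Suc: "us_growth \<nu> (Suc n) = us_growth \<nu> n * ((2 * \<nu> + real n) / (\<nu> + real n))"
  by (simp add: us_growth_def pochhammer_Suc)

text \<open>In the quotient of the Gamma series at \<nu> and 2\<nu> the factorials cancel and one
  power n^\<nu> survives in the denominator.\<close>

lemma us_growth_asymp:
  assumes "\<nu> > 0"
  shows "(\<lambda>n. us_growth \<nu> n / real n powr \<nu>) \<longlonglongrightarrow> Gamma \<nu> / Gamma (2 * \<nu>)"
proof -
  have "(\<lambda>n. Gamma_series' \<nu> n / Gamma_series' (2 * \<nu>) n) \<longlonglongrightarrow> Gamma \<nu> / Gamma (2 * \<nu>)"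
    using assms Gamma_real_pos[of "2 * \<nu>"]
    by (intro tendsto_divide Gamma_series'_LIMSEQ) linarith
  moreover have "\<forall>\<^sub>F n in sequentially.
      Gamma_series' \<nu> n / Gamma_series' (2 * \<nu>) n = us_growth \<nu> n / real n powr \<nu>"
    using eventually_gt_at_top[of 0]
  proof eventually_elim
    case (elim n)
    have "exp (2 * \<nu> * ln (real n)) = exp (\<nu> * ln (real n)) * exp (\<nu> * ln (real n))"
      by (simp flip: exp_add)
    then show ?case
      using elim by (simp add: Gamma_series'_def us_growth_def powr_def)
  qed
  ultimately show ?thesis
    by (rule Lim_transform_eventually)
qed

text \<open>The sequence g_n / n^\<nu> has a positive limit, so both it and its inverse are
  bounded.\<close>

lemma us_growth_ratio_le:
  assumes "\<nu> > 0"
  obtains C where "C > 0"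
    "\<And>N n. N \<ge> 1 \<Longrightarrow> n \<ge> 1 \<Longrightarrow> us_growth \<nu> N / us_growth \<nu> n \<le> C * (real N / real n) powr \<nu>"
proof -
  define u where "u n = us_growth \<nu> n / real n powr \<nu>" for n
  have u_pos: "u n > 0" if "n \<ge> 1" for n
    using that us_growth_pos[OF assms, of n] by (simp add: u_def)
  have u_lim: "u \<longlonglongrightarrow> Gamma \<nu> / Gamma (2 * \<nu>)" and lim_pos: "Gamma \<nu> / Gamma (2 * \<nu>) > 0"
    using us_growth_asymp[OF assms] assms by (simp_all add: u_def[abs_def])
  obtain A where A: "A > 0" "\<And>n. norm (u n) \<le> A"
    using convergent_imp_Bseq[OF convergentI[OF u_lim]] by (auto elim!: BseqE)
  have "(\<lambda>n. inverse (u n)) \<longlonglongrightarrow> inverse (Gamma \<nu> / Gamma (2 * \<nu>))"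
    using lim_pos by (intro tendsto_inverse u_lim) linarith
  then obtain B where B: "B > 0" "\<And>n. norm (inverse (u n)) \<le> B"
    by (meson BseqE convergentI convergent_imp_Bseq)
  show thesis
  proof (rule that[of "A * B"])
    show "A * B > 0" using A B by simp
    fix N n :: nat assume Nn: "N \<ge> 1" "n \<ge> 1"
    have "us_growth \<nu> N / us_growth \<nu> n = u N * inverse (u n) * (real N / real n) powr \<nu>"
      using Nn by (simp add: u_def powr_divide field_simps)
    also have "\<dots> \<le> A * B * (real N / real n) powr \<nu>"
      using A(2)[of N] B(2)[of n] u_pos[OF Nn(1)] u_pos[OF Nn(2)] A(1)
      by (intro mult_right_mono mult_mono) auto
    finally show "us_growth \<nu> N / us_growth \<nu> n \<le> A * B * (real N / real n) powr \<nu>" .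
  qed
qed

section \<open>Bounds where s n is small\<close>

text \<open>The index starts at 1 because the relation between \<open>r 0\<close>,
  \<open>r 1\<close> and \<open>r 2\<close> is the only one that the dilation alters.\<close>

definition us_recurrence :: "real \<Rightarrow> real \<Rightarrow> (nat \<Rightarrow> real) \<Rightarrow> bool" where
  "us_recurrence \<nu> x r \<longleftrightarrow> (\<forall>n\<ge>1. (2 * \<nu> + real n + 1) * r (Suc (Suc n)) =
      2 * x * (real n + 1 + \<nu>) * r (Suc n) - (real n + 1) * r n)"

lemma us_recurrenceD:
  "us_recurrence \<nu> x r \<Longrightarrow> n \<ge> 1 \<Longrightarrow> (2 * \<nu> + real n + 1) * r (Suc (Suc n)) =
      2 * x * (real n + 1 + \<nu>) * r (Suc n) - (real n + 1) * r n"
  by (simp add: us_recurrence_def)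

definition us_potential :: "real \<Rightarrow> (nat \<Rightarrow> real) \<Rightarrow> nat \<Rightarrow> real" where
  "us_potential \<nu> r n = (real n + 1) * \<bar>r (Suc n) - r n\<bar> + (2 * \<nu> - 1) * \<bar>r (Suc n)\<bar>"

text \<open>In the differences \<open>d\<close> the recurrence has leading coefficient 2\<nu> + n +
  1 = (n + 2) + (2\<nu> - 1). The part n + 2 is the weight in the next potential; the surplus 2\<nu>
  - 1 pays for replacing |r_(n+1)| by |r_(n+2)|.\<close>

lemma us_potential_Suc_le:
  assumes "\<nu> > 1 / 2" "us_recurrence \<nu> x r" "0 \<le> x" "x \<le> 1" "n \<ge> 1"
  shows "us_potential \<nu> r (Suc n) \<le>
      us_potential \<nu> r n + 2 * (1 - x\<^sup>2) * (real n + 1 + \<nu>) * \<bar>r (Suc n)\<bar>"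
proof -
  define d where "d k = r (Suc k) - r k" for k
  have "x * (1 - x) \<ge> 0" using assms by simp
  then have x: "1 - x \<le> 1 - x\<^sup>2" by (simp add: power2_eq_square algebra_simps)
  have "(2 * \<nu> + real n + 1) * d (Suc n) =
      (real n + 1) * d n - 2 * (1 - x) * (real n + 1 + \<nu>) * r (Suc n)"
    using us_recurrenceD[OF assms(2,5)] by (simp add: d_def algebra_simps)
  then have "\<bar>(2 * \<nu> + real n + 1) * d (Suc n)\<bar> \<le>
      \<bar>(real n + 1) * d n\<bar> + \<bar>2 * (1 - x) * (real n + 1 + \<nu>) * r (Suc n)\<bar>"
    by linarith
  also have "\<bar>2 * (1 - x) * (real n + 1 + \<nu>) * r (Suc n)\<bar> =
      (1 - x) * (2 * (real n + 1 + \<nu>) * \<bar>r (Suc n)\<bar>)"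
    using assms by (simp add: abs_mult) (simp add: algebra_simps)
  also have "\<dots> \<le> (1 - x\<^sup>2) * (2 * (real n + 1 + \<nu>) * \<bar>r (Suc n)\<bar>)"
    using x assms by (intro mult_right_mono) auto
  also have "\<bar>(2 * \<nu> + real n + 1) * d (Suc n)\<bar> = (2 * \<nu> + real n + 1) * \<bar>d (Suc n)\<bar>"
    using assms by (simp add: abs_mult)
  also have "\<bar>(real n + 1) * d n\<bar> = (real n + 1) * \<bar>d n\<bar>"
    by (simp add: abs_mult)
  finally have 1: "(2 * \<nu> + real n + 1) * \<bar>d (Suc n)\<bar> \<le> (real n + 1) * \<bar>d n\<bar>
      + 2 * (1 - x\<^sup>2) * (real n + 1 + \<nu>) * \<bar>r (Suc n)\<bar>"
    by (simp add: algebra_simps)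
  have "(2 * \<nu> - 1) * \<bar>r (Suc (Suc n))\<bar> \<le> (2 * \<nu> - 1) * (\<bar>d (Suc n)\<bar> + \<bar>r (Suc n)\<bar>)"
    using assms(1) by (intro mult_left_mono) (auto simp: d_def)
  with 1 show ?thesis
    by (simp add: us_potential_def flip: d_def) (simp add: algebra_simps)
qed

text \<open>Bootstrap: |r_k| \<le> 2A bounds each increment of the potential, and the smallness
  condition keeps their sum below the initial bound (2\<nu> - 1) A. The potential at most doubles
  this bound, which returns |r_(k+1)| \<le> 2A.\<close>

lemma us_recurrence_bounded:
  assumes nu: "\<nu> > 1 / 2" and rec: "us_recurrence \<nu> x r" and x: "0 \<le> x" "x \<le> 1"
    and r1: "\<bar>r 1\<bar> \<le> 2 * A" and P1: "us_potential \<nu> r 1 \<le> (2 * \<nu> - 1) * A"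
    and N: "N \<ge> 1" "N = 1 \<or> (1 - x\<^sup>2) * (real N * (real N + 2 * \<nu> + 1)) \<le> (2 * \<nu> - 1) / 2"
  shows "\<bar>r N\<bar> \<le> 2 * A" "real N * \<bar>r (Suc N) - r N\<bar> \<le> 2 * (2 * \<nu> - 1) * A"
proof -
  define y where "y = 1 - x\<^sup>2"
  have y: "y \<ge> 0" using x by (simp add: y_def power_le_one)
  have A: "A \<ge> 0" using r1 by linarith
  have bound: "us_potential \<nu> r n \<le> 2 * ((2 * \<nu> - 1) * A)"
    if "us_potential \<nu> r n \<le> (2 * \<nu> - 1) * A + 2 * A * y * (real n * (real n + 2 * \<nu> + 1))"
      "n \<le> N" "N \<noteq> 1" for n
  proof -
    have "y * (real n * (real n + 2 * \<nu> + 1)) \<le> y * (real N * (real N + 2 * \<nu> + 1))"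
      using that y nu by (intro mult_left_mono mult_mono) auto
    also have "\<dots> \<le> (2 * \<nu> - 1) / 2" using N that by (simp add: y_def)
    finally have "2 * A * (y * (real n * (real n + 2 * \<nu> + 1))) \<le> 2 * A * ((2 * \<nu> - 1) / 2)"
      using A by (intro mult_left_mono) auto
    with that(1) show ?thesis by (simp add: algebra_simps)
  qed
  \<comment> \<open>The product n (n + 2\<nu> + 1) has increments 2 (n + 1 + \<nu>), so it sums the
    error terms of \<open>us_potential_Suc_le\<close>.\<close>
  have "n \<le> N \<Longrightarrow> \<bar>r n\<bar> \<le> 2 * A \<and>
      us_potential \<nu> r n \<le> (2 * \<nu> - 1) * A + 2 * A * y * (real n * (real n + 2 * \<nu> + 1))"
    if "n \<ge> 1" for n
    using that
  proof (induction rule: nat_induct_at_least)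
    case base
    have "0 \<le> 2 * A * y * (real 1 * (real 1 + 2 * \<nu> + 1))" using A y nu by simp
    then show ?case using r1 P1 by linarith
  next
    case (Suc n)
    have "us_potential \<nu> r n \<le> 2 * ((2 * \<nu> - 1) * A)"
      using Suc by (intro bound) auto
    moreover have "(2 * \<nu> - 1) * \<bar>r (Suc n)\<bar> \<le> us_potential \<nu> r n"
      by (simp add: us_potential_def)
    ultimately have "(2 * \<nu> - 1) * \<bar>r (Suc n)\<bar> \<le> (2 * \<nu> - 1) * (2 * A)" by simp
    then have r: "\<bar>r (Suc n)\<bar> \<le> 2 * A" using nu by simp
    then have "2 * y * (real n + 1 + \<nu>) * \<bar>r (Suc n)\<bar> \<le> 2 * y * (real n + 1 + \<nu>) * (2 * A)"
      using y nu by (intro mult_left_mono) auto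
    with us_potential_Suc_le[OF nu rec x Suc.hyps] Suc r show ?case
      by (simp add: algebra_simps flip: y_def)
  qed
  from this[OF N(1)] have r: "\<bar>r N\<bar> \<le> 2 * A"
    and P: "us_potential \<nu> r N \<le> (2 * \<nu> - 1) * A + 2 * A * y * (real N * (real N + 2 * \<nu> + 1))"
    by auto
  show "\<bar>r N\<bar> \<le> 2 * A" by (rule r)
  have A': "(2 * \<nu> - 1) * A \<ge> 0" using A nu by simp
  have "us_potential \<nu> r N \<le> 2 * ((2 * \<nu> - 1) * A)"
    using bound[OF P] P1 A' by (cases "N = 1") auto
  moreover have "(2 * \<nu> - 1) * \<bar>r (Suc N)\<bar> \<ge> 0" using nu by simp
  ultimately show "real N * \<bar>r (Suc N) - r N\<bar> \<le> 2 * (2 * \<nu> - 1) * A"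
    unfolding us_potential_def using abs_ge_zero[of "r (Suc N) - r N"]
    by (simp add: algebra_simps)
qed

section \<open>Energy estimates where s n is large\<close>

text \<open>For s^2 = 1 - x^2 the radicand is v^2 - 2xuv + u^2, the invariant form of p_(n+1) = 2x
  p_n - p_(n-1). Written as a Euclidean norm it admits the triangle inequality.\<close>

definition energy :: "real \<Rightarrow> real \<Rightarrow> real \<Rightarrow> real \<Rightarrow> real" where
  "energy x s u v = sqrt ((v - x * u)\<^sup>2 + (s * u)\<^sup>2)"

lemma abs_le_energy: "\<bar>s * u\<bar> \<le> energy x s u v"
  unfolding energy_def by (rule real_le_rsqrt) simp

lemma energy_le: "energy x s u v \<le> \<bar>v - x * u\<bar> + \<bar>s * u\<bar>"
  unfolding energy_def by (rule sqrt_sum_squares_le_sum_abs)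

text \<open>For b = 1 the step preserves the energy. In general it adds (1 - b) u to one coordinate,
  and |u| is at most the energy divided by s.\<close>

lemma energy_step:
  assumes "s > 0" "s\<^sup>2 = 1 - x\<^sup>2"
  shows "energy x s v (2 * x * v - b * u) \<le> (1 + \<bar>1 - b\<bar> / s) * energy x s u v"
proof -
  have "energy x s v (2 * x * v - b * u) =
      sqrt (((x * v - u) + (1 - b) * u)\<^sup>2 + (s * v + 0)\<^sup>2)"
    unfolding energy_def by (simp add: algebra_simps)
  also have "\<dots> \<le> sqrt ((x * v - u)\<^sup>2 + (s * v)\<^sup>2) + sqrt (((1 - b) * u)\<^sup>2 + 0\<^sup>2)"
    by (rule real_sqrt_sum_squares_triangle_ineq)
  also have "(x * v - u)\<^sup>2 + (s * v)\<^sup>2 = (v - x * u)\<^sup>2 + (s * u)\<^sup>2"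
    unfolding power_mult_distrib assms(2) by (simp add: power2_eq_square algebra_simps)
  also have "sqrt (((1 - b) * u)\<^sup>2 + 0\<^sup>2) = \<bar>1 - b\<bar> / s * \<bar>s * u\<bar>"
    using assms(1) by (simp add: abs_mult)
  also have "\<dots> \<le> \<bar>1 - b\<bar> / s * energy x s u v"
    using assms(1) by (intro mult_left_mono abs_le_energy) auto
  finally show ?thesis
    by (simp add: energy_def distrib_right)
qed

text \<open>The form as a difference of reciprocals lets the deviations telescope in
  \<open>energy_growth\<close>.\<close>

lemma us_beta_deviation:
  assumes "\<nu> > 0" "n \<ge> 1"
  shows "\<bar>1 - 4 * us_beta \<nu> (Suc n)\<bar> = \<nu> * \<bar>1 - \<nu>\<bar> * (1 / (real n + \<nu>) - 1 / (real n + 1 + \<nu>))"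
proof -
  have "1 - 4 * us_beta \<nu> (Suc n) = \<nu> * (\<nu> - 1) * (1 / (real n + \<nu>) - 1 / (real n + 1 + \<nu>))"
    using assms by (simp add: us_beta_def divide_simps) (simp add: algebra_simps)
  moreover have "1 / (real n + \<nu>) - 1 / (real n + 1 + \<nu>) \<ge> 0"
    using assms by (simp add: divide_simps)
  ultimately show ?thesis
    using assms by (simp add: abs_mult abs_minus_commute)
qed

lemma us_growth_recurrence:
  assumes "\<nu> > 0" "us_recurrence \<nu> x r" "n \<ge> 1"
  shows "us_growth \<nu> (Suc (Suc n)) * r (Suc (Suc n)) =
      2 * x * (us_growth \<nu> (Suc n) * r (Suc n)) - 4 * us_beta \<nu> (Suc n) * (us_growth \<nu> n * r n)"
proof -
  have r: "r (Suc (Suc n)) =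
      (2 * x * (real n + 1 + \<nu>) * r (Suc n) - (real n + 1) * r n) / (2 * \<nu> + real n + 1)"
    using us_recurrenceD[OF assms(2,3)] assms(1) by (simp add: field_simps)
  show ?thesis
    unfolding r using assms(1)
    by (simp add: us_growth_Suc us_beta_def divide_simps) (simp add: algebra_simps)
qed

lemma energy_growth:
  assumes nu: "\<nu> > 0" and rec: "us_recurrence \<nu> x r" and s: "s > 0" "s\<^sup>2 = 1 - x\<^sup>2"
    and N: "N \<ge> 1" "N \<le> n"
  defines "p \<equiv> \<lambda>k. us_growth \<nu> k * r k"
  shows "energy x s (p n) (p (Suc n)) \<le>
      exp (\<nu> * \<bar>1 - \<nu>\<bar> / (s * real N)) * energy x s (p N) (p (Suc N))"
proof -
  define \<kappa> where "\<kappa> = \<nu> * \<bar>1 - \<nu>\<bar> / s"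
  define e where "e k = energy x s (p k) (p (Suc k))" for k
  have e: "e k \<ge> 0" for k by (simp add: e_def energy_def)
  have \<kappa>: "\<kappa> \<ge> 0" using nu s by (simp add: \<kappa>_def)
  \<comment> \<open>The induction carries the exact telescoped exponent, using 1 + h \<le> exp h; it
    is coarsened to \<kappa> / N only afterwards.\<close>
  have "e n \<le> exp (\<kappa> * (1 / (real N + \<nu>) - 1 / (real n + \<nu>))) * e N"
    using N(2)
  proof (induction rule: nat_induct_at_least)
    case base
    show ?case by simp
  next
    case (Suc n)
    define h where "h = \<kappa> * (1 / (real n + \<nu>) - 1 / (real n + 1 + \<nu>))"
    have n: "n \<ge> 1" using Suc N by simp
    have "e (Suc n) \<le> (1 + \<bar>1 - 4 * us_beta \<nu> (Suc n)\<bar> / s) * e n"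
      using energy_step[OF s] us_growth_recurrence[OF nu rec n] by (simp add: e_def p_def)
    also have "\<bar>1 - 4 * us_beta \<nu> (Suc n)\<bar> / s = h"
      using us_beta_deviation[OF nu n] by (simp add: h_def \<kappa>_def)
    also have "(1 + h) * e n \<le> exp h * e n"
      using e by (intro mult_right_mono exp_ge_add_one_self)
    also have "\<dots> \<le> exp h * (exp (\<kappa> * (1 / (real N + \<nu>) - 1 / (real n + \<nu>))) * e N)"
      using Suc by (intro mult_left_mono) auto
    also have "\<dots> = exp (\<kappa> * (1 / (real N + \<nu>) - 1 / (real (Suc n) + \<nu>))) * e N"
      by (simp add: h_def algebra_simps flip: exp_add)
    finally show ?case .
  qed
  also have "\<kappa> * (1 / (real N + \<nu>) - 1 / (real n + \<nu>)) \<le> \<kappa> * (1 / real N)"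
  proof (rule mult_left_mono[OF _ \<kappa>])
    have "1 / (real N + \<nu>) \<le> 1 / real N" "1 / (real n + \<nu>) \<ge> 0"
      using nu N by (simp_all add: frac_le)
    then show "1 / (real N + \<nu>) - 1 / (real n + \<nu>) \<le> 1 / real N" by linarith
  qed
  finally show ?thesis
    using e[of N] by (simp add: e_def \<kappa>_def mult_right_mono)
qed

text \<open>The starting energy at N is of order A g_N / N. It grows up to n only by the exponential
  factor, and it bounds s g_n |r_n|.\<close>

lemma us_recurrence_decay_oscillatory:
  assumes nu: "\<nu> > 1 / 2" and rec: "us_recurrence \<nu> x r" and x: "0 \<le> x" "x \<le> 1"
    and s: "s > 0" "s\<^sup>2 = 1 - x\<^sup>2" and N: "N \<ge> 1" "N \<le> n" "s * real N \<le> 1"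
    and rN: "\<bar>r N\<bar> \<le> 2 * A" and dN: "real N * \<bar>r (Suc N) - r N\<bar> \<le> 2 * (2 * \<nu> - 1) * A"
  shows "\<bar>r n\<bar> \<le> 10 * \<nu> * A * exp (\<nu> * \<bar>1 - \<nu>\<bar> / (s * real N)) / (s * real N)
      * (us_growth \<nu> N / us_growth \<nu> n)"
proof -
  define p where "p k = us_growth \<nu> k * r k" for k
  define g where "g = us_growth \<nu> N"
  define F where "F = exp (\<nu> * \<bar>1 - \<nu>\<bar> / (s * real N))"
  have nu0: "\<nu> > 0" using nu by simp
  have g: "g > 0" and gn: "us_growth \<nu> n > 0" using us_growth_pos[OF nu0] by (simp_all add: g_def)
  have A: "A \<ge> 0" using rN by linarith
  have N0: "real N > 0" using N by simp
  have s_le: "s \<le> 1 / real N" using N N0 by (simp add: field_simps)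
  have "s * 1 \<le> s * real N" using s N by (intro mult_left_mono) auto
  then have "s \<le> 1" using N(3) by simp
  then have s_sq: "s\<^sup>2 \<le> s"
    using s(1) mult_left_le[of s s] by (simp only: power2_eq_square)
  \<comment> \<open>The chain is 1 - x \<le> 1 - x^2 = s^2 \<le> s \<le> 1 / N.\<close>
  have "x\<^sup>2 \<le> x" using x mult_left_le[of x x] by (simp only: power2_eq_square)
  with s_sq s(2) s_le have x1: "1 - x \<le> 1 / real N" by linarith
  \<comment> \<open>Since g_(N+1) / g_N = 1 + \<nu> / (\<nu> + N), the three terms come from the
    change of r, the change of g, and 1 - x; each is of order A / N.\<close>
  have "p (Suc N) - x * p N =
      g * ((2 * \<nu> + real N) / (\<nu> + real N) * (r (Suc N) - r N) + (\<nu> / (\<nu> + real N)) * r N + (1 - x) * r N)"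
    using nu N0 by (simp add: p_def g_def us_growth_Suc divide_simps) (simp add: algebra_simps)
  also have "\<bar>\<dots>\<bar> \<le> g * (2 * \<bar>r (Suc N) - r N\<bar> + (\<nu> / real N) * \<bar>r N\<bar> + (1 / real N) * \<bar>r N\<bar>)"
  proof -
    have "\<bar>(2 * \<nu> + real N) / (\<nu> + real N) * (r (Suc N) - r N)\<bar> \<le> 2 * \<bar>r (Suc N) - r N\<bar>"
      unfolding abs_mult using nu N0 by (intro mult_right_mono) (auto simp: divide_simps)
    moreover have "\<bar>(\<nu> / (\<nu> + real N)) * r N\<bar> \<le> (\<nu> / real N) * \<bar>r N\<bar>"
      unfolding abs_mult using nu N0 by (intro mult_right_mono) (auto simp: frac_le)
    moreover have "\<bar>(1 - x) * r N\<bar> \<le> (1 / real N) * \<bar>r N\<bar>"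
      unfolding abs_mult using x x1 by (intro mult_right_mono) auto
    ultimately have "\<bar>(2 * \<nu> + real N) / (\<nu> + real N) * (r (Suc N) - r N)
        + (\<nu> / (\<nu> + real N)) * r N + (1 - x) * r N\<bar>
        \<le> 2 * \<bar>r (Suc N) - r N\<bar> + (\<nu> / real N) * \<bar>r N\<bar> + (1 / real N) * \<bar>r N\<bar>"
      by linarith
    then show ?thesis
      unfolding abs_mult[of g] abs_of_pos[OF g] by (rule mult_left_mono) (use g in simp)
  qed
  finally have v: "\<bar>p (Suc N) - x * p N\<bar> \<le>
      g * (2 * \<bar>r (Suc N) - r N\<bar> + (\<nu> / real N) * \<bar>r N\<bar> + (1 / real N) * \<bar>r N\<bar>)" .
  have u: "\<bar>s * p N\<bar> \<le> g * ((1 / real N) * \<bar>r N\<bar>)"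
  proof -
    have "\<bar>s * p N\<bar> = g * (s * \<bar>r N\<bar>)" using s g by (simp add: p_def abs_mult flip: g_def)
    also have "\<dots> \<le> g * ((1 / real N) * \<bar>r N\<bar>)"
      using s_le g by (intro mult_left_mono mult_right_mono) auto
    finally show ?thesis .
  qed
  have "energy x s (p N) (p (Suc N)) \<le>
      g * (2 * \<bar>r (Suc N) - r N\<bar> + (\<nu> / real N) * \<bar>r N\<bar> + 2 * ((1 / real N) * \<bar>r N\<bar>))"
    using order_trans[OF energy_le add_mono[OF v u]] by (simp add: algebra_simps)
  also have "\<dots> = g / real N * (2 * (real N * \<bar>r (Suc N) - r N\<bar>) + (\<nu> + 2) * \<bar>r N\<bar>)"
    using N0 by (simp add: field_simps)
  also have "\<dots> \<le> g / real N * (2 * (2 * (2 * \<nu> - 1) * A) + (\<nu> + 2) * (2 * A))"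
    using g N0 nu dN rN by (intro mult_left_mono add_mono) auto
  \<comment> \<open>4 (2\<nu> - 1) + 2 (\<nu> + 2) = 10\<nu>.\<close>
  also have "\<dots> = 10 * \<nu> * A * g / real N" by (simp add: field_simps)
  finally have E: "energy x s (p N) (p (Suc N)) \<le> 10 * \<nu> * A * g / real N" .
  have "\<bar>s * p n\<bar> \<le> energy x s (p n) (p (Suc n))" by (rule abs_le_energy)
  also have "\<dots> \<le> F * energy x s (p N) (p (Suc N))"
    using energy_growth[OF nu0 rec s N(1,2)] by (simp add: p_def F_def)
  also have "\<dots> \<le> F * (10 * \<nu> * A * g / real N)"
    using E by (intro mult_left_mono) (auto simp: F_def)
  finally have "s * us_growth \<nu> n * \<bar>r n\<bar> \<le> F * (10 * \<nu> * A * g / real N)"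
    using s gn by (simp add: p_def abs_mult)
  then show ?thesis
    using s gn N0 by (simp add: field_simps flip: F_def g_def)
qed

section \<open>Joining the two regimes\<close>

lemma us_recurrence_decay:
  assumes nu: "\<nu> > 1 / 2"
  obtains K where "K > 0"
    "\<And>x r A n. \<lbrakk>us_recurrence \<nu> x r; 0 \<le> x; x \<le> 1; \<bar>r 1\<bar> \<le> 2 * A;
        us_potential \<nu> r 1 \<le> (2 * \<nu> - 1) * A; n \<ge> 1\<rbrakk>
      \<Longrightarrow> \<bar>r n\<bar> \<le> K * A / (sqrt (1 - x\<^sup>2) * real n + 1) powr \<nu>"
proof -
  have nu0: "\<nu> > 0" using nu by simp
  obtain G where G: "G > 0" "\<And>N n. N \<ge> 1 \<Longrightarrow> n \<ge> 1 \<Longrightarrow>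
      us_growth \<nu> N / us_growth \<nu> n \<le> G * (real N / real n) powr \<nu>"
    using us_growth_ratio_le[OF nu0] by blast
  \<comment> \<open>The largest \<open>c\<close> for which \<open>s N \<le> c\<close> implies the smallness condition of
    \<open>us_recurrence_bounded\<close>, by \<open>N (N + 2\<nu> + 1) \<le> (2\<nu> + 2) N\<^sup>2\<close>.\<close>
  define c where "c = sqrt ((2 * \<nu> - 1) / (4 * (\<nu> + 1)))"
  have c2: "c\<^sup>2 = (2 * \<nu> - 1) / (4 * (\<nu> + 1))" using nu by (simp add: c_def)
  have c0: "c > 0" using nu by (simp add: c_def)
  have c1: "c \<le> 1" using nu by (simp add: c_def divide_simps)
  \<comment> \<open>\<open>K1\<close> serves the range s n > c, where the energy argument starts at
    an N with s N \<ge> c / 2; the other summand of \<open>K\<close> serves s n \<le> c, where s n +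
    1 \<le> 2.\<close>
  define K1 where "K1 = 20 * \<nu> / c * exp (2 * \<nu> * \<bar>1 - \<nu>\<bar> / c) * G * (1 + 1 / c) powr \<nu>"
  define K where "K = 2 * 2 powr \<nu> + K1"
  have "1 + 1 / c > 0" using c0 by (simp add: add_pos_pos)
  then have K1: "K1 > 0" using nu c0 G(1) by (simp add: K1_def)
  show thesis
  proof (rule that[of K])
    show "K > 0" using K1 by (simp add: K_def add_pos_pos)
  next
    fix x :: real and r A and n :: nat
    assume rec: "us_recurrence \<nu> x r" and x: "0 \<le> x" "x \<le> 1" and r1: "\<bar>r 1\<bar> \<le> 2 * A"
      and P1: "us_potential \<nu> r 1 \<le> (2 * \<nu> - 1) * A" and n: "n \<ge> 1"
    define s where "s = sqrt (1 - x\<^sup>2)"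
    have s2: "s\<^sup>2 = 1 - x\<^sup>2" and s0: "s \<ge> 0" and s1: "s \<le> 1"
      using x by (auto simp: s_def power_le_one)
    have A: "A \<ge> 0" using r1 by linarith
    have sn: "s * real n \<ge> 0" using s0 by simp
    have bdd: "\<bar>r N\<bar> \<le> 2 * A" "real N * \<bar>r (Suc N) - r N\<bar> \<le> 2 * (2 * \<nu> - 1) * A"
      if "N \<ge> 1" "N = 1 \<or> s * real N \<le> c" for N
    proof -
      have "(1 - x\<^sup>2) * (real N * (real N + 2 * \<nu> + 1)) \<le> (2 * \<nu> - 1) / 2" if "s * real N \<le> c"
      proof -
        have "real N * (real N + 2 * \<nu> + 1) \<le> real N * (real N * (2 * \<nu> + 2))"
        proof (rule mult_left_mono)
          have "(real N - 1) * (2 * \<nu> + 1) \<ge> 0" using \<open>N \<ge> 1\<close> nu by simp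
          then show "real N + 2 * \<nu> + 1 \<le> real N * (2 * \<nu> + 2)" by (simp add: algebra_simps)
        qed simp
        then have "s\<^sup>2 * (real N * (real N + 2 * \<nu> + 1)) \<le> s\<^sup>2 * (real N * (real N * (2 * \<nu> + 2)))"
          by (rule mult_left_mono) simp
        also have "\<dots> = (s * real N)\<^sup>2 * (2 * \<nu> + 2)" by (simp add: power2_eq_square)
        also have "\<dots> \<le> c\<^sup>2 * (2 * \<nu> + 2)"
          using that s0 nu by (intro mult_right_mono power_mono) auto
        also have "\<dots> = (2 * \<nu> - 1) / 2" using nu by (simp add: c2 field_simps)
        finally show ?thesis by (simp add: s2)
      qed
      with that have "N = 1 \<or> (1 - x\<^sup>2) * (real N * (real N + 2 * \<nu> + 1)) \<le> (2 * \<nu> - 1) / 2"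
        by blast
      from us_recurrence_bounded[OF nu rec x r1 P1 that(1) this]
      show "\<bar>r N\<bar> \<le> 2 * A" "real N * \<bar>r (Suc N) - r N\<bar> \<le> 2 * (2 * \<nu> - 1) * A" .
    qed
    have "\<bar>r n\<bar> * (s * real n + 1) powr \<nu> \<le> K * A"
    proof (cases "s * real n \<le> c")
      case True
      have "\<bar>r n\<bar> * (s * real n + 1) powr \<nu> \<le> 2 * A * 2 powr \<nu>"
        using bdd(1)[OF n] True c1 nu A sn by (intro mult_mono powr_mono2) auto
      also have "\<dots> \<le> K * A" using A K1 by (simp add: K_def algebra_simps)
      finally show ?thesis .
    next
      case False
      with s0 c0 have s: "s > 0" by (cases "s = 0") auto
      \<comment> \<open>The last index with s N \<le> c, or 1 if s > c leaves none. In both cases c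
        / 2 \<le> s N \<le> 1, the lower bound because c / s < floor(c / s) + 1 \<le> 2N.\<close>
      define N where "N = max 1 (nat \<lfloor>c / s\<rfloor>)"
      have N1: "N \<ge> 1" by (simp add: N_def)
      have fl: "real (nat \<lfloor>c / s\<rfloor>) \<le> c / s" using c0 s by (intro of_nat_floor) auto
      have small: "N = 1 \<or> s * real N \<le> c"
        using fl s by (auto simp: N_def max_def field_simps)
      have "c / s < real n" using False s by (simp add: field_simps)
      with fl have "nat \<lfloor>c / s\<rfloor> \<le> n" by linarith
      then have Nn: "N \<le> n" using n by (simp add: N_def)
      have sN1: "s * real N \<le> 1" using small s1 c1 by auto
      have "c / s \<le> 2 * real N"
        using real_of_int_floor_add_one_gt[of "c / s"] by (simp add: N_def max_def) linarith
      then have sN: "s * real N \<ge> c / 2" using s by (simp add: field_simps)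
      have "\<bar>r n\<bar> \<le> 10 * \<nu> * A * exp (\<nu> * \<bar>1 - \<nu>\<bar> / (s * real N)) / (s * real N)
          * (us_growth \<nu> N / us_growth \<nu> n)"
        by (rule us_recurrence_decay_oscillatory[OF nu rec x s s2 N1 Nn sN1 bdd[OF N1 small]])
      also have "\<dots> \<le> 10 * \<nu> * A * exp (\<nu> * \<bar>1 - \<nu>\<bar> / (c / 2)) / (c / 2)
          * (G * (real N / real n) powr \<nu>)"
        using nu A c0 sN G(2)[OF N1 n] us_growth_pos[OF nu0, of N] us_growth_pos[OF nu0, of n]
        by (intro mult_mono frac_le mult_left_mono iffD2[OF exp_le_cancel_iff] divide_left_mono
            mult_nonneg_nonneg mult_pos_pos divide_nonneg_pos) auto
      also have "\<dots> = 20 * \<nu> / c * exp (2 * \<nu> * \<bar>1 - \<nu>\<bar> / c) * G * A * (real N / real n) powr \<nu>"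
        by (simp add: algebra_simps)
      finally have r_le: "\<bar>r n\<bar> \<le>
          20 * \<nu> / c * exp (2 * \<nu> * \<bar>1 - \<nu>\<bar> / c) * G * A * (real N / real n) powr \<nu>" .
      have "\<bar>r n\<bar> * (s * real n + 1) powr \<nu> \<le>
          20 * \<nu> / c * exp (2 * \<nu> * \<bar>1 - \<nu>\<bar> / c) * G * A
            * ((real N / real n) powr \<nu> * (s * real n + 1) powr \<nu>)"
        using mult_right_mono[OF r_le, of "(s * real n + 1) powr \<nu>"] by (simp add: mult.assoc)
      also have "\<dots> \<le> 20 * \<nu> / c * exp (2 * \<nu> * \<bar>1 - \<nu>\<bar> / c) * G * A * (1 + 1 / c) powr \<nu>"
      proof (rule mult_left_mono)
        \<comment> \<open>The product N / n * (s n + 1) equals s N + N / n, with s N \<le> 1 and N /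
          n \<le> 1 / c.\<close>
        have "real N / real n \<le> 1 / (s * real n)"
          using sN1 s n by (simp add: field_simps)
        also have "\<dots> \<le> 1 / c" using False c0 by (intro divide_left_mono) auto
        finally have "real N / real n * (s * real n + 1) \<le> 1 + 1 / c"
          using sN1 n by (simp add: distrib_left mult.commute)
        then show "(real N / real n) powr \<nu> * (s * real n + 1) powr \<nu> \<le> (1 + 1 / c) powr \<nu>"
          using nu0 sn by (simp add: powr_mono2 flip: powr_mult)
      qed (use nu0 c0 G(1) A in simp)
      also have "\<dots> = K1 * A" by (simp add: K1_def)
      also have "\<dots> \<le> K * A" using A by (intro mult_right_mono) (auto simp: K_def)
      finally show ?thesis .
    qed
    moreover have "(s * real n + 1) powr \<nu> > 0" using sn by simp
    ultimately show "\<bar>r n\<bar> \<le> K * A / (sqrt (1 - x\<^sup>2) * real n + 1) powr \<nu>"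
      by (simp add: pos_le_divide_eq flip: s_def)
  qed
qed

section \<open>The normalized co-dilated polynomials\<close>

definition codil_normalized :: "real \<Rightarrow> real \<Rightarrow> real \<Rightarrow> nat \<Rightarrow> real" where
  "codil_normalized \<nu> lam x n = 2 ^ n * poly (codil_us \<nu> lam n) x / us_growth \<nu> n"

lemma codil_normalized_1: "\<nu> > 0 \<Longrightarrow> codil_normalized \<nu> lam x 1 = x"
  by (simp add: codil_normalized_def us_growth_def)

lemma codil_normalized_2:
  assumes "\<nu> > 0"
  shows "codil_normalized \<nu> lam x (Suc 1) = (2 * (1 + \<nu>) * x\<^sup>2 - lam) / (2 * \<nu> + 1)"
  using assms
  by (simp add: codil_normalized_def us_growth_def us_beta_def pochhammer_Suc divide_simps)
    (simp add: algebra_simps power2_eq_square)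

lemma us_recurrence_codil_normalized:
  assumes nu: "\<nu> > 0"
  shows "us_recurrence \<nu> x (codil_normalized \<nu> lam x)"
  unfolding us_recurrence_def
proof (intro allI impI)
  fix n :: nat assume "n \<ge> 1"
  \<comment> \<open>This shape selects the last equation of \<open>codil_us\<close>, which is free
    of \<lambda>.\<close>
  then obtain m where m: "n = Suc m" by (cases n) auto
  have g: "us_growth \<nu> n > 0" using us_growth_pos[OF nu] .
  define a where "a = poly (codil_us \<nu> lam n) x"
  define b where "b = poly (codil_us \<nu> lam (Suc n)) x"
  have c: "poly (codil_us \<nu> lam (Suc (Suc n))) x = x * b - us_beta \<nu> (Suc n) * a"
    by (simp add: a_def b_def m)
  show "(2 * \<nu> + real n + 1) * codil_normalized \<nu> lam x (Suc (Suc n)) =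
      2 * x * (real n + 1 + \<nu>) * codil_normalized \<nu> lam x (Suc n)
      - (real n + 1) * codil_normalized \<nu> lam x n"
    unfolding codil_normalized_def c a_def[symmetric] b_def[symmetric]
    using nu g by (simp add: us_growth_Suc us_beta_def divide_simps) (simp add: algebra_simps)
qed

text \<open>The initial potential is at most linear in |\<lambda>|, so the general decay applies
  with A a multiple of 1 + |\<lambda>|.\<close>

lemma codil_normalized_decay:
  assumes nu: "\<nu> > 1 / 2"
  obtains K where "K > 0"
    "\<And>lam x n. \<lbrakk>0 \<le> x; x \<le> 1; n \<ge> 1\<rbrakk> \<Longrightarrow>
      \<bar>codil_normalized \<nu> lam x n\<bar> \<le> K * (1 + \<bar>lam\<bar>) / (sqrt (1 - x\<^sup>2) * real n + 1) powr \<nu>"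
proof -
  obtain K where K: "K > 0" "\<And>x r A n. \<lbrakk>us_recurrence \<nu> x r; 0 \<le> x; x \<le> 1; \<bar>r 1\<bar> \<le> 2 * A;
        us_potential \<nu> r 1 \<le> (2 * \<nu> - 1) * A; n \<ge> 1\<rbrakk>
      \<Longrightarrow> \<bar>r n\<bar> \<le> K * A / (sqrt (1 - x\<^sup>2) * real n + 1) powr \<nu>"
    using us_recurrence_decay[OF nu] by blast
  \<comment> \<open>Chosen so that (2\<nu> - 1) a = 4 + 2\<nu>, the factor that bounds the initial
    potential below; a \<ge> 1 also covers |r_1| = x.\<close>
  define a where "a = (4 + 2 * \<nu>) / (2 * \<nu> - 1)"
  have a: "a \<ge> 1" "(2 * \<nu> - 1) * a = 4 + 2 * \<nu>" using nu by (simp_all add: a_def)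
  show thesis
  proof (rule that[of "K * a"])
    show "K * a > 0" using K a by simp
    fix lam x :: real and n :: nat
    assume x: "0 \<le> x" "x \<le> 1" and n: "n \<ge> 1"
    define r where "r = codil_normalized \<nu> lam x"
    have rec: "us_recurrence \<nu> x r" using us_recurrence_codil_normalized nu by (simp add: r_def)
    have r1: "r 1 = x" using codil_normalized_1 nu by (simp add: r_def)
    have r2: "r (Suc 1) = (2 * (1 + \<nu>) * x\<^sup>2 - lam) / (2 * \<nu> + 1)"
      using codil_normalized_2 nu by (simp add: r_def)
    have "\<bar>(2 * \<nu> + 1) * r (Suc 1)\<bar> = \<bar>2 * (1 + \<nu>) * x\<^sup>2 - lam\<bar>"
      unfolding r2 using nu by simp
    also have "\<dots> \<le> 2 * (1 + \<nu>) * x\<^sup>2 + \<bar>lam\<bar>"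
    proof -
      have "2 * (1 + \<nu>) * x\<^sup>2 \<ge> 0" using nu by simp
      then show ?thesis by linarith
    qed
    also have "2 * (1 + \<nu>) * x\<^sup>2 \<le> 2 * (1 + \<nu>) * 1"
      using x nu by (intro mult_left_mono) (auto simp: power_le_one)
    finally have "(2 * \<nu> + 1) * \<bar>r (Suc 1)\<bar> \<le> 2 * (1 + \<nu>) + \<bar>lam\<bar>"
      using nu by (simp add: abs_mult)
    moreover have "us_potential \<nu> r 1 \<le> (2 * \<nu> + 1) * \<bar>r (Suc 1)\<bar> + 2"
      using abs_triangle_ineq4[of "r (Suc 1)" "r 1"] x unfolding us_potential_def r1
      by (simp add: algebra_simps)
    moreover have "2 * (1 + \<nu>) + \<bar>lam\<bar> + 2 \<le> (4 + 2 * \<nu>) * (1 + \<bar>lam\<bar>)"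
      using nu by (simp add: algebra_simps)
    ultimately have "us_potential \<nu> r 1 \<le> (4 + 2 * \<nu>) * (1 + \<bar>lam\<bar>)"
      by linarith
    then have P: "us_potential \<nu> r 1 \<le> (2 * \<nu> - 1) * (a * (1 + \<bar>lam\<bar>))"
      by (simp add: a(2) flip: mult.assoc)
    have "1 \<le> a * (1 + \<bar>lam\<bar>)" using mult_mono[of 1 a 1 "1 + \<bar>lam\<bar>"] a by simp
    with x r1 have "\<bar>r 1\<bar> \<le> 2 * (a * (1 + \<bar>lam\<bar>))" by simp
    from K(2)[OF rec x this P n]
    show "\<bar>codil_normalized \<nu> lam x n\<bar> \<le>
        K * a * (1 + \<bar>lam\<bar>) / (sqrt (1 - x\<^sup>2) * real n + 1) powr \<nu>"
      by (simp add: r_def mult.assoc)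
  qed
qed

text \<open>The first-order recurrence at x = 1 propagates the bound from n = 2. The start matters:
  at n = 1 the value is 1, which is below the bound when \<lambda> < -1.\<close>

lemma codil_normalized_one_ge:
  assumes nu: "\<nu> > 1 / 2" and lam: "lam < 2 * \<nu>" and n: "n \<ge> 2"
  shows "codil_normalized \<nu> lam 1 n \<ge> (2 * \<nu> - lam) / (2 * \<nu> + 1)"
proof -
  define r where "r = codil_normalized \<nu> lam 1"
  have rec: "us_recurrence \<nu> 1 r" using us_recurrence_codil_normalized nu by (simp add: r_def)
  have r1: "r 1 = 1" using codil_normalized_1 nu by (simp add: r_def)
  have r2: "r (Suc 1) = (2 * (1 + \<nu>) - lam) / (2 * \<nu> + 1)"
    using codil_normalized_2 nu by (simp add: r_def)
  \<comment> \<open>At x = 1 the quantity (2\<nu> + k) r_(k+1) - (k + 1) r_k does not depend on k;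
    at k = 1 it is 2\<nu> - \<lambda>.\<close>
  have first_order: "(2 * \<nu> + real k) * r (Suc k) = (real k + 1) * r k + 2 * \<nu> - lam" if "k \<ge> 1" for k
    using that
  proof (induction rule: nat_induct_at_least)
    case base
    show ?case using nu by (simp add: r1[simplified] r2[simplified])
  next
    case (Suc k)
    then show ?case using us_recurrenceD[OF rec Suc.hyps] by (simp add: algebra_simps)
  qed
  have "r n \<ge> (2 * \<nu> - lam) / (2 * \<nu> + 1)"
    using n
  proof (induction rule: nat_induct_at_least)
    case base
    show ?case using nu by (simp add: r2[simplified] numeral_2_eq_2 divide_right_mono)
  next
    case (Suc k)
    define q where "q = (2 * \<nu> - lam) / (2 * \<nu> + 1)"
    have q: "q \<ge> 0" "2 * \<nu> - lam = (2 * \<nu> + 1) * q" using nu lam by (simp_all add: q_def)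
    have "(real k + 1) * q \<le> (real k + 1) * r k"
      using Suc.IH by (intro mult_left_mono) (auto simp: q_def)
    then have "(2 * \<nu> + real k) * r (Suc k) \<ge> (real k + 1) * q + (2 * \<nu> + 1) * q"
      using first_order[of k] Suc.hyps q(2) by linarith
    moreover have "(real k + 1) * q + (2 * \<nu> + 1) * q \<ge> (2 * \<nu> + real k) * q"
      using q(1) by (simp add: algebra_simps)
    ultimately have "(2 * \<nu> + real k) * q \<le> (2 * \<nu> + real k) * r (Suc k)" by linarith
    moreover have "2 * \<nu> + real k > 0" using nu by simp
    ultimately have "q \<le> r (Suc k)" by (simp only: mult_le_cancel_left_pos)
    then show ?case by (simp only: q_def)
  qed
  then show ?thesis by (simp add: r_def)
qed

section \<open>Bounds for the residual polynomials and the modulus\<close>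

lemma residual_eq_codil_normalized:
  assumes "\<nu> > 0"
  shows "residual \<nu> lam n y =
    codil_normalized \<nu> lam (sqrt (1 - y)) (2 * n) / codil_normalized \<nu> lam 1 (2 * n)"
  using us_growth_pos[OF assms, of "2 * n"] by (simp add: residual_def codil_normalized_def)

theorem corollary5p2:
  fixes \<nu> :: real
  assumes "\<nu> > 1 / 2"
  shows "\<exists>C :: real. \<forall>lam :: real. lam < 2 * \<nu> \<longrightarrow> (\<forall>n :: nat. n \<ge> 1 \<longrightarrow>
    (\<forall>y\<in>{0..1}. \<bar>residual \<nu> lam n y\<bar>
        \<le> (1 + \<bar>lam\<bar>) / (2 * \<nu> - lam) * (C / (2 * sqrt y * real n + 1) powr \<nu>)) \<and>
    conv_modulus \<nu> lam n
        \<le> (1 + \<bar>lam\<bar>) / (2 * \<nu> - lam) * (C / (2 * real n) powr \<nu>))"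
proof -
  obtain K where K: "K > 0" "\<And>lam x n. \<lbrakk>0 \<le> x; x \<le> 1; n \<ge> 1\<rbrakk> \<Longrightarrow>
      \<bar>codil_normalized \<nu> lam x n\<bar> \<le> K * (1 + \<bar>lam\<bar>) / (sqrt (1 - x\<^sup>2) * real n + 1) powr \<nu>"
    using codil_normalized_decay[OF assms] by blast
  \<comment> \<open>The factor 2\<nu> + 1 comes from the lower bound of the denominator.\<close>
  define C where "C = K * (2 * \<nu> + 1)"
  show ?thesis
  proof (intro exI[of _ C] allI impI conjI)
    fix lam :: real and n :: nat
    assume lam: "lam < 2 * \<nu>" and n: "n \<ge> 1"
    define M where "M = (1 + \<bar>lam\<bar>) / (2 * \<nu> - lam)"
    have MC: "M * C \<ge> 0" using K lam assms by (simp add: M_def C_def)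
    have q: "(2 * \<nu> - lam) / (2 * \<nu> + 1) > 0" using lam assms by simp
    have res: "\<bar>residual \<nu> lam n y\<bar> \<le> M * (C / (2 * sqrt y * real n + 1) powr \<nu>)"
      if y: "y \<in> {0..1}" for y
    proof -
      have "\<bar>residual \<nu> lam n y\<bar> =
          \<bar>codil_normalized \<nu> lam (sqrt (1 - y)) (2 * n)\<bar> / \<bar>codil_normalized \<nu> lam 1 (2 * n)\<bar>"
        using residual_eq_codil_normalized assms by simp
      also have "\<dots> \<le> K * (1 + \<bar>lam\<bar>) / (sqrt (1 - (sqrt (1 - y))\<^sup>2) * real (2 * n) + 1) powr \<nu>
          / ((2 * \<nu> - lam) / (2 * \<nu> + 1))"
        using y n q K(1) codil_normalized_one_ge[OF assms lam, of "2 * n"]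
        by (intro frac_le K(2)) auto
      also have "\<dots> = M * (C / (2 * sqrt y * real n + 1) powr \<nu>)"
        using y by (simp add: M_def C_def mult_ac)
      finally show ?thesis .
    qed
    then show "\<forall>y\<in>{0..1}. \<bar>residual \<nu> lam n y\<bar> \<le>
        (1 + \<bar>lam\<bar>) / (2 * \<nu> - lam) * (C / (2 * sqrt y * real n + 1) powr \<nu>)"
      by (simp add: M_def)
    have "conv_modulus \<nu> lam n \<le> M * (C / (2 * real n) powr \<nu>)"
      unfolding conv_modulus_def
    proof (rule cSUP_least)
      fix y :: real assume y: "y \<in> {0..1}"
      show "\<bar>y powr (\<nu> / 2) * residual \<nu> lam n y\<bar> \<le> M * (C / (2 * real n) powr \<nu>)"
      proof (cases "y = 0")
        \<comment> \<open>Here \<open>0 powr (\<nu> / 2) = 0\<close>, so the left side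
          vanishes.\<close>
        case True
        then show ?thesis using MC by simp
      next
        case False
        then have y0: "y > 0" using y by simp
        have p: "y powr (\<nu> / 2) = sqrt y powr \<nu>"
          using y0 by (simp add: powr_powr flip: powr_half_sqrt)
        have "\<bar>y powr (\<nu> / 2) * residual \<nu> lam n y\<bar> = sqrt y powr \<nu> * \<bar>residual \<nu> lam n y\<bar>"
          by (simp add: abs_mult p)
        also have "\<dots> \<le> sqrt y powr \<nu> * (M * (C / (2 * sqrt y * real n + 1) powr \<nu>))"
          by (intro mult_left_mono res y) simp
        \<comment> \<open>Once the summand 1 is dropped, the powers of \<open>sqrt y\<close>
          cancel.\<close>
        also have "\<dots> \<le> sqrt y powr \<nu> * (M * C / (2 * sqrt y * real n) powr \<nu>)"
        proof -
          have pos: "2 * sqrt y * real n > 0" using y0 n by simp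
          have "M * C / (2 * sqrt y * real n + 1) powr \<nu> \<le> M * C / (2 * sqrt y * real n) powr \<nu>"
            using MC pos n y0 assms by (intro frac_le powr_mono2) auto
          then show ?thesis unfolding times_divide_eq_right[of M] by (rule mult_left_mono) simp
        qed
        also have "\<dots> = M * (C / (2 * real n) powr \<nu>)"
          using y0 n by (simp add: powr_mult)
        finally show ?thesis .
      qed
    qed simp
    then show "conv_modulus \<nu> lam n \<le> (1 + \<bar>lam\<bar>) / (2 * \<nu> - lam) * (C / (2 * real n) powr \<nu>)"
      by (simp add: M_def)
  qed
qed

end
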